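(* Let $\alpha_k$ be defined by $\alpha_k=q^{6r^2-4r}$ if $k=3r-1$, $\alpha_k=q^{6r^2+4r}$ if $k=3r$, $\alpha_k=-q^{6r^2+8r+2}-q^{6r^2+4r}$ if $k=3r+1$. Then for every integer $p\ge1$, every positive integer $N$ and every primitive $N$th root of unity $q$, $$H_p^{(7)}(q)=q\sum_{k=0}^{N-1}(-1)^kq^{\binom{k+1}{2}+(p-1)(k^2+k)}\alpha_k.$$
   Context: $(a)_n=\prod_{k=1}^n(1-aq^{k-1})$, $\begin{bmatrix} n\\ k\end{bmatrix}=\frac{(q)_n}{(q)_{n-k}(q)_k}$. $H_p^{(7)}(q)=\sum_{n_p\ge\cdots\ge n_1\ge0}q^{-n_p^2-n_p}(q^{n_p+1})_{n_p}\prod_{i=1}^{p-1}q^{n_i^2+n_i}\begin{bmatrix} n_{i+1}\\ n_i\end{bmatrix}$; at a root of unity only finitely many terms are nonzero. *)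

theory Defs
  imports "HOL-Analysis.Analysis"
begin

definition primitive_root_of_unity :: "nat \<Rightarrow> complex \<Rightarrow> bool" where
  "primitive_root_of_unity N q \<longleftrightarrow>
     N > 0 \<and> q ^ N = 1 \<and> (\<forall>m. 0 < m \<and> m < N \<longrightarrow> q ^ m \<noteq> 1)"

definition q_pochhammer :: "complex \<Rightarrow> complex \<Rightarrow> nat \<Rightarrow> complex" where
  "q_pochhammer a q n = (\<Prod>k = 1..n. 1 - a * q ^ (k - 1))"

text \<open>Only meaningful if the denominator is nonzero; see the remark on \<open>H7\<close> below.\<close>

definition q_binomial :: "complex \<Rightarrow> nat \<Rightarrow> nat \<Rightarrow> complex" where
  "q_binomial q n k =
     q_pochhammer q q n / (q_pochhammer q q (n - k) * q_pochhammer q q k)"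

text \<open>The tuples \<open>n\<^sub>p \<ge> \<dots> \<ge> n\<^sub>1 \<ge> 0\<close>, as functions that are \<open>undefined\<close> outside \<open>{1..p}\<close>.\<close>

definition index_tuples :: "nat \<Rightarrow> (nat \<Rightarrow> nat) set" where
  "index_tuples p = {n \<in> {1..p} \<rightarrow>\<^sub>E UNIV. \<forall>i \<in> {1..<p}. n i \<le> n (i + 1)}"

definition H7_term :: "nat \<Rightarrow> complex \<Rightarrow> (nat \<Rightarrow> nat) \<Rightarrow> complex" where
  "H7_term p q n =
     q powi (- (int (n p))\<^sup>2 - int (n p)) * q_pochhammer (q ^ (n p + 1)) q (n p) *
     (\<Prod>i = 1..p - 1. q ^ ((n i)\<^sup>2 + n i) * q_binomial q (n (i + 1)) (n i))"

text \<open>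
  At a primitive \<open>N\<close>-th root of unity the factor \<open>(q\<^bsup>m + 1\<^esup>)\<^sub>m\<close>, where \<open>m = n\<^sub>p\<close>, vanishes for
  \<open>m \<ge> N\<close>. If \<open>m < N\<close>, then all \<open>n\<^sub>i < N\<close> and no denominator in the \<open>q\<close>-binomials is zero.
  So the sum has finite support, and the convention for division by zero does not affect it;
  both facts are proved below.
\<close>

definition H7 :: "nat \<Rightarrow> complex \<Rightarrow> complex" where
  "H7 p q = (\<Sum>\<^sub>\<infinity>n \<in> index_tuples p. H7_term p q n)"

text \<open>
  In the first case \<open>r \<ge> 1\<close>, so the natural-number subtraction does not truncate.
\<close>

definition alpha :: "complex \<Rightarrow> nat \<Rightarrow> complex" where
  "alpha q k =
     (if k mod 3 = 2 then let r = (k + 1) div 3 in q ^ (6 * r\<^sup>2 - 4 * r)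
      else if k mod 3 = 0 then let r = k div 3 in q ^ (6 * r\<^sup>2 + 4 * r)
      else let r = k div 3 in - (q ^ (6 * r\<^sup>2 + 8 * r + 2)) - q ^ (6 * r\<^sup>2 + 4 * r))"

lemma alpha_cases:
  shows "r \<ge> 1 \<Longrightarrow> alpha q (3 * r - 1) = q powi (6 * (int r)\<^sup>2 - 4 * int r)"
    and "alpha q (3 * r) = q ^ (6 * r\<^sup>2 + 4 * r)"
    and "alpha q (3 * r + 1) = - (q ^ (6 * r\<^sup>2 + 8 * r + 2)) - q ^ (6 * r\<^sup>2 + 4 * r)"
proof -
  assume r: "r \<ge> 1"
  then obtain s where s: "r = s + 1"
    by (metis add.commute le_Suc_ex)
  have "r * 1 \<le> r * r" using r by (intro mult_le_mono) auto
  then have le: "4 * r \<le> 6 * r\<^sup>2"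
    unfolding power2_eq_square by linarith
  have k: "(3 * r - 1) mod 3 = 2" "(3 * r - 1 + 1) div 3 = r"
  proof -
    have "3 * r - 1 = 2 + 3 * s" using s by simp
    then show "(3 * r - 1) mod 3 = 2" by (simp only: mod_mult_self2) simp
    show "(3 * r - 1 + 1) div 3 = r" using r by simp
  qed
  have "int (6 * r\<^sup>2 - 4 * r) = 6 * (int r)\<^sup>2 - 4 * int r"
    using le by (simp add: of_nat_diff)
  then show "alpha q (3 * r - 1) = q powi (6 * (int r)\<^sup>2 - 4 * int r)"
    unfolding alpha_def k Let_def by (simp flip: power_int_of_nat)
next
  show "alpha q (3 * r) = q ^ (6 * r\<^sup>2 + 4 * r)"
    by (simp add: alpha_def)
next
  have k: "(3 * r + 1) mod 3 = 1" "(3 * r + 1) div 3 = r"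
    by simp_all
  show "alpha q (3 * r + 1) = - (q ^ (6 * r\<^sup>2 + 8 * r + 2)) - q ^ (6 * r\<^sup>2 + 4 * r)"
    unfolding alpha_def k by simp
qed

lemma q_pochhammer_root_eq_0:
  assumes "primitive_root_of_unity N q" and "m \<ge> N"
  shows "q_pochhammer (q ^ (m + 1)) q m = 0"
proof -
  define j where "j = N * (m div N + 1) - m"
  have N: "N > 0" "q ^ N = 1"
    using assms by (auto simp: primitive_root_of_unity_def)
  define b where "b = N * (m div N)"
  have "m = b + m mod N" unfolding b_def by simp
  moreover have "m mod N < N" using N by simp
  moreover have "m div N \<ge> 1"
    using assms(2) N by (simp add: Suc_leI div_greater_zero_iff)
  then have "N \<le> b" unfolding b_def by simp
  moreover have "j = b + N - m" unfolding j_def b_def by (simp add: algebra_simps)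
  ultimately have "j + m = b + N" "1 \<le> j" "j \<le> m"
    by linarith+
  then have *: "j + m = N * (m div N + 1)" "1 \<le> j" "j \<le> m"
    by (simp_all add: b_def)
  have "q ^ (m + 1) * q ^ (j - 1) = q ^ (j + m)"
    using *(2) by (simp only: power_add [symmetric]) (simp add: algebra_simps)
  also have "\<dots> = 1"
    unfolding *(1) power_mult N(2) by simp
  finally show ?thesis
    unfolding q_pochhammer_def using *(2,3) by (intro prod_zero) auto
qed

lemma q_pochhammer_root_neq_0:
  assumes "primitive_root_of_unity N q" and "m < N"
  shows "q_pochhammer q q m \<noteq> 0"
proof -
  have "1 - q * q ^ (k - 1) \<noteq> 0" if "k \<in> {1..m}" for k
  proof -
    have "q * q ^ (k - 1) = q ^ k"
      using that by (cases k) auto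
    moreover have "q ^ k \<noteq> 1"
      using assms that by (auto simp: primitive_root_of_unity_def)
    ultimately show ?thesis by simp
  qed
  then show ?thesis
    unfolding q_pochhammer_def by simp
qed

lemma index_tuples_le:
  assumes "n \<in> index_tuples p" and "i \<in> {1..p}"
  shows "n i \<le> n p"
proof -
  have step: "n j \<le> n (Suc j)" if "j \<in> {1..<p}" for j
    using assms(1) that by (auto simp: index_tuples_def)
  have "i \<le> p" using assms(2) by simp
  then show ?thesis
  proof (induction rule: inc_induct)
    case (step j)
    then show ?case
      using assms(2) \<open>\<And>j. j \<in> {1..<p} \<Longrightarrow> n j \<le> n (Suc j)\<close>[of j] by simp
  qed simp
qed

lemma finite_H7_support:
  assumes "primitive_root_of_unity N q"
  shows "finite {n \<in> index_tuples p. H7_term p q n \<noteq> 0}"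
proof (rule finite_subset)
  show "finite ({1..p} \<rightarrow>\<^sub>E {..<N})"
    by (intro finite_PiE) auto
  show "{n \<in> index_tuples p. H7_term p q n \<noteq> 0} \<subseteq> {1..p} \<rightarrow>\<^sub>E {..<N}"
  proof
    fix n assume n: "n \<in> {n \<in> index_tuples p. H7_term p q n \<noteq> 0}"
    then have "q_pochhammer (q ^ (n p + 1)) q (n p) \<noteq> 0"
      by (auto simp: H7_term_def)
    with q_pochhammer_root_eq_0[OF assms] have "n p < N"
      by (meson not_le)
    with index_tuples_le n have "\<forall>i \<in> {1..p}. n i < N"
      by (metis (mono_tags, lifting) le_less_trans mem_Collect_eq)
    with n show "n \<in> {1..p} \<rightarrow>\<^sub>E {..<N}"
      by (auto simp: index_tuples_def PiE_iff)
  qed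
qed

end

theory Submission
  imports Defs
begin

text \<open>
  Let \<open>T\<close> be the operator \<open>(T f)(n) = \<Sum>\<^sub>m q\<^bsup>m\<^sup>2 + m\<^esup> [n, m] f(m)\<close>, so that \<open>H\<^sub>p\<close> is a functional \<open>L\<close> applied to
  \<open>T\<^sup>p \<delta>\<^sub>0\<close>. The rows of the inverse Bailey matrix relative to \<open>a = q\<close> (\<open>bailey_weight q k\<close>)
  are left eigenvectors of \<open>T\<close> with eigenvalue \<open>q\<^bsup>k\<^sup>2 + k\<^esup>\<close> (a \<open>q\<close>-Vandermonde sum). At a
  primitive \<open>N\<close>-th root of unity, \<open>L\<close> is the combination of these rows for \<open>k < N\<close> with coefficients
  \<open>q\<^bsup>1 - k\<^sup>2\<^esup> \<alpha>\<^sub>k\<close>: by the \<open>q\<close>-Lucas congruence and the reflection \<open>[N-1-d, i] \<leftrightarrow> [d+i, i]\<close> the entry at \<open>j\<close> is the case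
  \<open>n = N - 1 - j\<close> of Slater's identity \<open>\<Sum>\<^sub>k \<alpha>\<^sub>k [2n+1, n-k] = q\<^sup>n\<close>, which holds for every \<open>q \<noteq> 0\<close> and
  follows from Pascal's rule once it is written as a sum over all integers.
\<close>

subsection \<open>Gaussian binomial coefficients\<close>

text \<open>Taking Pascal's rule as the definition keeps the values meaningful at roots of unity,
  where a quotient of q-factorials may be 0/0. The integer lower index lets sums run over all
  integers without boundary cases.\<close>

fun gauss_binomial :: "'a::field \<Rightarrow> nat \<Rightarrow> int \<Rightarrow> 'a" where
  "gauss_binomial q 0 j = (if j = 0 then 1 else 0)"
| "gauss_binomial q (Suc n) j = gauss_binomial q n (j - 1) + q powi j * gauss_binomial q n j"

lemma gauss_binomial_eq_0: "j < 0 \<or> j > int n \<Longrightarrow> gauss_binomial q n j = 0"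
  by (induction n arbitrary: j) auto

lemma gauss_binomial_0_right [simp]: "gauss_binomial q n 0 = 1"
  by (induction n) (auto simp: gauss_binomial_eq_0)

text \<open>The mirror image of the defining Pascal rule. After expanding both terms by the
  induction hypothesis, the terms regroup because the middle coefficient is
  \<open>q powi (n + 1)\<close> under either rule.\<close>

lemma gauss_binomial_Suc':
  assumes "q \<noteq> 0"
  shows "gauss_binomial q (Suc n) j =
    q powi (int n + 1 - j) * gauss_binomial q n (j - 1) + gauss_binomial q n j"
proof (induction n arbitrary: j)
  case 0
  then show ?case by auto
next
  case (Suc n)
  have 1: "q powi (int (Suc n) + 1 - j) * q powi (j - 1) = q powi (int n + 1)"
    using assms by (simp add: add.commute flip: power_int_add)
  have 2: "q powi j * q powi (int n + 1 - j) = q powi (int n + 1)"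
    using assms by (simp add: add.commute flip: power_int_add)
  have "gauss_binomial q (Suc (Suc n)) j = gauss_binomial q (Suc n) (j - 1)
      + q powi j * gauss_binomial q (Suc n) j"
    by simp
  also have "\<dots> = (q powi (int n + 1 - (j - 1)) * gauss_binomial q n (j - 1 - 1) + gauss_binomial q n (j - 1))
     + q powi j * (q powi (int n + 1 - j) * gauss_binomial q n (j - 1) + gauss_binomial q n j)"
    by (simp only: Suc.IH)
  also have "\<dots> = (q powi (int n + 1 - (j - 1)) * gauss_binomial q n (j - 1 - 1) + gauss_binomial q n (j - 1))
     + ((q powi j * q powi (int n + 1 - j)) * gauss_binomial q n (j - 1) + q powi j * gauss_binomial q n j)"
    by (simp only: algebra_simps)
  also have "\<dots> = q powi (int (Suc n) + 1 - j) * gauss_binomial q n (j - 1 - 1)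
       + (q powi (int (Suc n) + 1 - j) * q powi (j - 1)) * gauss_binomial q n (j - 1)
       + gauss_binomial q n (j - 1) + q powi j * gauss_binomial q n j"
    unfolding 1 2 by (simp add: algebra_simps)
  also have "\<dots> = q powi (int (Suc n) + 1 - j) * gauss_binomial q (Suc n) (j - 1) + gauss_binomial q (Suc n) j"
    by (simp add: distrib_left mult.assoc)
  finally show ?case .
qed

lemma gauss_binomial_sym:
  assumes "q \<noteq> 0"
  shows "gauss_binomial q n (int n - j) = gauss_binomial q n j"
proof (induction n arbitrary: j)
  case (Suc n)
  have "gauss_binomial q (Suc n) (int (Suc n) - j) =
      gauss_binomial q n (int n - j) + q powi (int n + 1 - j) * gauss_binomial q n (int n - (j - 1))"
    by (simp add: algebra_simps)
  also have "\<dots> = gauss_binomial q (Suc n) j"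
    unfolding Suc.IH gauss_binomial_Suc'[OF assms] by simp
  finally show ?case .
qed auto

text \<open>Both Pascal rules compute \<open>[n + 1, j]\<close>; equate them.\<close>

lemma gauss_binomial_step:
  assumes "q \<noteq> 0"
  shows "(1 - q powi j) * gauss_binomial q n j = (1 - q powi (int n + 1 - j)) * gauss_binomial q n (j - 1)"
  using gauss_binomial_Suc'[OF assms, of n j] by (simp add: algebra_simps)

text \<open>The q-analogue of \<open>j C(n+1, j) = (n+1) C(n, j-1)\<close>: in Pascal's rule,
  \<open>[n, j]\<close> is eliminated by \<open>gauss_binomial_step\<close>.\<close>

lemma gauss_binomial_absorb:
  assumes "q \<noteq> 0"
  shows "(1 - q powi j) * gauss_binomial q (Suc n) j = (1 - q powi (int n + 1)) * gauss_binomial q n (j - 1)"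
proof -
  have "(1 - q powi j) * gauss_binomial q (Suc n) j =
      (1 - q powi j) * gauss_binomial q n (j - 1) + q powi j * ((1 - q powi j) * gauss_binomial q n j)"
    by (simp add: algebra_simps)
  also have "\<dots> = (1 - q powi j * q powi (int n + 1 - j)) * gauss_binomial q n (j - 1)"
    unfolding gauss_binomial_step[OF assms] by (simp add: algebra_simps)
  also have "q powi j * q powi (int n + 1 - j) = q powi (int n + 1)"
    using assms by (simp flip: power_int_add)
  finally show ?thesis .
qed

lemma q_pochhammer_0 [simp]: "q_pochhammer a q 0 = 1"
  by (simp add: q_pochhammer_def)

lemma q_pochhammer_Suc: "q_pochhammer a q (Suc n) = q_pochhammer a q n * (1 - a * q ^ n)"
  by (simp add: q_pochhammer_def)

lemma q_pochhammer_add: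
  "q_pochhammer a q (m + n) = q_pochhammer a q m * q_pochhammer (a * q ^ m) q n"
  by (induction n) (auto simp: q_pochhammer_Suc power_add algebra_simps)

lemma q_pochhammer_Suc': "q_pochhammer a q (Suc n) = (1 - a) * q_pochhammer (a * q) q n"
  using q_pochhammer_add[of a q 1 n] by (simp add: q_pochhammer_Suc)

text \<open>The factorial formula in division-free form, so that it also holds where a denominator
  vanishes. Each step of the induction on \<open>k\<close> is one absorption.\<close>

lemma gauss_binomial_q_pochhammer:
  assumes "q \<noteq> 0"
  shows "gauss_binomial q (m + k) (int k) * (q_pochhammer q q k * q_pochhammer q q m) = q_pochhammer q q (m + k)"
proof (induction k)
  case (Suc k)
  have "(1 - q powi (int k + 1)) * gauss_binomial q (Suc (m + k)) (int k + 1) =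
     (1 - q powi (int (m + k) + 1)) * gauss_binomial q (m + k) (int k)"
    using gauss_binomial_absorb[OF assms, of "int k + 1" "m + k"] by simp
  then have *: "(1 - q * q ^ k) * gauss_binomial q (Suc (m + k)) (int k + 1) =
     (1 - q * q ^ (m + k)) * gauss_binomial q (m + k) (int k)"
    using assms by (simp add: power_int_add mult.commute flip: of_nat_add)
  have "gauss_binomial q (m + Suc k) (int (Suc k)) * (q_pochhammer q q (Suc k) * q_pochhammer q q m)
    = ((1 - q * q ^ k) * gauss_binomial q (Suc (m + k)) (int k + 1)) * (q_pochhammer q q k * q_pochhammer q q m)"
    by (simp add: q_pochhammer_Suc algebra_simps del: gauss_binomial.simps)
  also have "\<dots> = (1 - q * q ^ (m + k)) * q_pochhammer q q (m + k)"
    unfolding * Suc.IH[symmetric] by (simp add: mult.assoc)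
  finally show ?case by (simp add: q_pochhammer_Suc mult.commute)
qed simp

text \<open>The expansion of the monomial \<open>x ^ r\<close> in the basis \<open>(x)_i\<close>.
  Pascal's rule splits the sum for \<open>r + 1\<close>: by
  \<open>(x)_{i+1} = (1 - x) (xq)_i\<close> one half is \<open>1 - x\<close> times the sum for
  \<open>r\<close> at \<open>x * q\<close>, the other is \<open>- (q ^ r)\<close> times the sum at
  \<open>x\<close>. Hence \<open>x\<close> is arbitrary in the induction.\<close>

lemma q_vandermonde:
  fixes q :: complex
  shows "(\<Sum>i\<le>r. (- 1) ^ (r - i) * q ^ ((r - i) choose 2) * gauss_binomial q r (int i) * q_pochhammer x q i)
     = (- 1) ^ r * q ^ (r choose 2) * x ^ r"
proof (induction r arbitrary: x)
  case (Suc r)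
  let ?f = "\<lambda>x i. (- 1) ^ (r - i) * q ^ ((r - i) choose 2) * gauss_binomial q r (int i) * q_pochhammer x q i"
  have "(\<Sum>i\<le>Suc r. (- 1) ^ (Suc r - i) * q ^ ((Suc r - i) choose 2) * gauss_binomial q (Suc r) (int i) * q_pochhammer x q i)
    = (\<Sum>i\<le>Suc r. (- 1) ^ (Suc r - i) * q ^ ((Suc r - i) choose 2) * gauss_binomial q r (int i - 1) * q_pochhammer x q i)
    + (\<Sum>i\<le>Suc r. (- 1) ^ (Suc r - i) * q ^ ((Suc r - i) choose 2) * q ^ i * gauss_binomial q r (int i) * q_pochhammer x q i)"
    by (simp add: algebra_simps sum.distrib)
  also have "(\<Sum>i\<le>Suc r. (- 1) ^ (Suc r - i) * q ^ ((Suc r - i) choose 2) * gauss_binomial q r (int i - 1) * q_pochhammer x q i)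
    = (\<Sum>i\<le>r. (- 1) ^ (r - i) * q ^ ((r - i) choose 2) * gauss_binomial q r (int i) * q_pochhammer x q (Suc i))"
    unfolding sum.atMost_Suc_shift by (simp add: gauss_binomial_eq_0)
  also have "\<dots> = (1 - x) * (\<Sum>i\<le>r. ?f (x * q) i)"
    unfolding sum_distrib_left by (intro sum.cong) (auto simp: q_pochhammer_Suc')
  also have "(\<Sum>i\<le>Suc r. (- 1) ^ (Suc r - i) * q ^ ((Suc r - i) choose 2) * q ^ i * gauss_binomial q r (int i) * q_pochhammer x q i)
    = (\<Sum>i\<le>r. (- 1) ^ (Suc r - i) * q ^ ((Suc r - i) choose 2) * q ^ i * gauss_binomial q r (int i) * q_pochhammer x q i)"
    by (simp add: gauss_binomial_eq_0)
  also have "\<dots> = - (q ^ r) * (\<Sum>i\<le>r. ?f x i)"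
    unfolding sum_distrib_left
  proof (intro sum.cong refl)
    fix i assume "i \<in> {..r}"
    then obtain s where s: "r = i + s" by (auto simp: le_iff_add)
    have "Suc r - i = Suc s" "r - i = s" "Suc s choose 2 = (s choose 2) + s"
      by (auto simp: s numeral_2_eq_2)
    then show "(- 1) ^ (Suc r - i) * q ^ ((Suc r - i) choose 2) * q ^ i * gauss_binomial q r (int i) * q_pochhammer x q i
       = - (q ^ r) * ?f x i"
      by (simp add: power_add s)
  qed
  finally show ?case
    unfolding Suc.IH by (simp add: numeral_2_eq_2 power_add power_mult_distrib algebra_simps)
qed simp

subsection \<open>A theta-type sum of Gaussian binomials\<close>

text \<open>The window is not invariant under \<open>r -> -1 - r\<close>, but every \<open>r\<close>
  with \<open>f r\<close> nonzero lies strictly inside it, so its reflection stays in the window and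
  only zero terms are left unmatched.\<close>

lemma sum_reflect_int:
  fixes f :: "int \<Rightarrow> 'a::comm_monoid_add"
  assumes c: "c = - 1 \<or> c = 0" and f: "\<And>r. \<bar>r\<bar> \<ge> M \<Longrightarrow> f r = 0"
  shows "(\<Sum>r\<in>{-M..M}. f (c - r)) = (\<Sum>r\<in>{-M..M}. f r)"
proof (rule sum.reindex_bij_witness_not_neutral[where i = "\<lambda>r. c - r" and j = "\<lambda>r. c - r"
        and S' = "{r \<in> {-M..M}. f (c - r) = 0}" and T' = "{r \<in> {-M..M}. f r = 0}"])
  have f': "\<bar>r\<bar> < M" if "f r \<noteq> 0" for r
    using f that by (meson not_le)
  show "c - a \<in> {-M..M} - {r \<in> {-M..M}. f r = 0}" if "a \<in> {-M..M} - {r \<in> {-M..M}. f (c - r) = 0}" for a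
    using f'[of "c - a"] that by auto
  show "c - b \<in> {-M..M} - {r \<in> {-M..M}. f (c - r) = 0}" if "b \<in> {-M..M} - {r \<in> {-M..M}. f r = 0}" for b
    using f'[of b] that c by auto
  show "finite {r \<in> {-M..M}. f (c - r) = 0}" "finite {r \<in> {-M..M}. f r = 0}"
    by (rule finite_subset[of _ "{-M..M}"]; auto)+
qed auto

lemma powi_distrib:
  fixes q :: "'a::field"
  shows "q powi a * (b + c) = q powi a * b + q powi a * c"
    and "q powi a * (b - c) = q powi a * b - q powi a * c"
  by (rule distrib_left right_diff_distrib)+

lemma powi_mult_gauss:
  fixes q :: "'a::field"
  assumes "q \<noteq> 0" and "a + b = c"
  shows "q powi a * (q powi b * g) = q powi c * g"
  using assms by (auto simp: power_int_add)

text \<open>Pascal's rule changes each summand by \<open>?h r - ?h (- 1 - r)\<close>, where the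
  symmetry of the Gaussian binomial turns the second correction into a reflected copy of the first.
  The reflection \<open>r -> -1 - r\<close> then cancels the total change; the bound on
  \<open>M\<close> keeps the whole support inside the window.\<close>

lemma theta_shift:
  fixes q :: "'a::field"
  assumes q: "q \<noteq> 0" and M: "int n + 3 \<le> M"
  shows "(\<Sum>r\<in>{-M..M}. q powi (6*r^2+r) * gauss_binomial q (2*n+1) (int n - 3*r)
             - q powi (6*r^2+5*r+1) * gauss_binomial q (2*n+1) (int n - 3*r - 1))
       = (\<Sum>r\<in>{-M..M}. q powi (6*r^2+r) * gauss_binomial q (2*n) (int n - 3*r)
             - q powi (6*r^2+5*r+1) * gauss_binomial q (2*n) (int n - 3*r - 1))"
    (is "?A (2*n+1) = ?A (2*n)")
proof -
  let ?g = "gauss_binomial q (2*n)"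
  let ?h = "\<lambda>r. q powi (6*r^2+4*r+int n+1) * ?g (int n - 3*r - 1)"
  have "q powi (6*r^2+r) * gauss_binomial q (2*n+1) (int n - 3*r)
      - q powi (6*r^2+5*r+1) * gauss_binomial q (2*n+1) (int n - 3*r - 1)
    = (q powi (6*r^2+r) * ?g (int n - 3*r) - q powi (6*r^2+5*r+1) * ?g (int n - 3*r - 1))
      + (?h r - ?h (- 1 - r))" for r
  proof -
    have e1: "gauss_binomial q (2*n+1) (int n - 3*r) =
       q powi (int n + 1 + 3*r) * ?g (int n - 3*r - 1) + ?g (int n - 3*r)"
      using gauss_binomial_Suc'[OF q, of "2*n" "int n - 3*r"] by (simp add: algebra_simps)
    have e2: "gauss_binomial q (2*n+1) (int n - 3*r - 1) =
       q powi (int n + 2 + 3*r) * ?g (int n - 3*r - 2) + ?g (int n - 3*r - 1)"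
      using gauss_binomial_Suc'[OF q, of "2*n" "int n - 3*r - 1"] by (simp add: algebra_simps)
    have e3: "?g (int n - 3*r - 2) = ?g (int n - 3*(- 1 - r) - 1)"
      using gauss_binomial_sym[OF q, of "2*n" "int n - 3*r - 2"] by (simp add: algebra_simps)
    have e4: "q powi (6*r^2+r) * (q powi (int n + 1 + 3*r) * ?g (int n - 3*r - 1)) = ?h r"
      by (rule powi_mult_gauss[OF q]) simp
    have e5: "q powi (6*r^2+5*r+1) * (q powi (int n + 2 + 3*r) * ?g (int n - 3*(- 1 - r) - 1)) = ?h (- 1 - r)"
      by (rule powi_mult_gauss[OF q]) (simp add: power2_eq_square algebra_simps)
    show ?thesis
      unfolding e1 e2 e3 powi_distrib e4 e5 by (simp only: algebra_simps)
  qed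
  then have "?A (2*n+1) = ?A (2*n) + (\<Sum>r\<in>{-M..M}. ?h r - ?h (- 1 - r))"
    by (simp only: sum.distrib)
  also have "(\<Sum>r\<in>{-M..M}. ?h (- 1 - r)) = (\<Sum>r\<in>{-M..M}. ?h r)"
    by (rule sum_reflect_int) (use M in \<open>auto intro!: gauss_binomial_eq_0\<close>)
  then have "(\<Sum>r\<in>{-M..M}. ?h r - ?h (- 1 - r)) = 0"
    unfolding sum_subtractf by simp
  finally show ?thesis by simp
qed

text \<open>A finite form of Euler's pentagonal number theorem: the two exponents are the pentagonal
  numbers of even and of odd index. The upper index grows from \<open>2n\<close> to
  \<open>2n+1\<close> by \<open>theta_shift\<close>, and from there to \<open>2n+2\<close> by the
  same argument with the reflection \<open>r -> -r\<close>.\<close>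

lemma theta_eq_1:
  fixes q :: "'a::field"
  assumes q: "q \<noteq> 0" and M: "int n + 3 \<le> M"
  shows "(\<Sum>r\<in>{-M..M}. q powi (6*r^2+r) * gauss_binomial q (2*n) (int n - 3*r)
             - q powi (6*r^2+5*r+1) * gauss_binomial q (2*n) (int n - 3*r - 1)) = 1"
  using M
proof (induction n)
  case 0
  have "(\<Sum>r\<in>{-M..M}. q powi (6*r^2+r) * gauss_binomial q (2*0) (int 0 - 3*r)
             - q powi (6*r^2+5*r+1) * gauss_binomial q (2*0) (int 0 - 3*r - 1))
       = (\<Sum>r\<in>{-M..M}. if r = 0 then 1 else 0)"
  proof (intro sum.cong refl)
    fix r :: int
    \<comment> \<open>For \<open>n = 0\<close> the lower index \<open>-3r - 1\<close> of the second
      binomial is never 0.\<close>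
    have "- (3 * r) \<noteq> 1" by presburger
    then show "q powi (6*r^2+r) * gauss_binomial q (2*0) (int 0 - 3*r)
             - q powi (6*r^2+5*r+1) * gauss_binomial q (2*0) (int 0 - 3*r - 1) = (if r = 0 then 1 else 0)"
      by simp
  qed
  then show ?case using 0 by simp
next
  case (Suc n)
  let ?g = "gauss_binomial q (2*n+1)"
  let ?h = "\<lambda>r. q powi (6*r^2+2*r+int n+1) * ?g (int n - 3*r)"
  have "q powi (6*r^2+r) * gauss_binomial q (2*Suc n) (int (Suc n) - 3*r)
      - q powi (6*r^2+5*r+1) * gauss_binomial q (2*Suc n) (int (Suc n) - 3*r - 1)
    = (q powi (6*r^2+r) * ?g (int n - 3*r) - q powi (6*r^2+5*r+1) * ?g (int n - 3*r - 1))
      + (?h (0 - r) - ?h r)" for r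
  proof -
    have e1: "gauss_binomial q (2*Suc n) (int (Suc n) - 3*r) =
       ?g (int n - 3*r) + q powi (int n + 1 - 3*r) * ?g (int n + 1 - 3*r)"
      using gauss_binomial.simps(2)[of q "2*n+1" "int n + 1 - 3*r"] by (simp add: algebra_simps del: gauss_binomial.simps)
    have e2: "gauss_binomial q (2*Suc n) (int (Suc n) - 3*r - 1) =
       ?g (int n - 3*r - 1) + q powi (int n - 3*r) * ?g (int n - 3*r)"
      using gauss_binomial.simps(2)[of q "2*n+1" "int n - 3*r"] by (simp add: algebra_simps del: gauss_binomial.simps)
    have e3: "?g (int n + 1 - 3*r) = ?g (int n - 3*(0-r))"
      using gauss_binomial_sym[OF q, of "2*n+1" "int n + 1 - 3*r"] by (simp add: algebra_simps del: gauss_binomial.simps)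
    have e4: "q powi (6*r^2+r) * (q powi (int n + 1 - 3*r) * ?g (int n - 3*(0-r))) = ?h (0 - r)"
      by (rule powi_mult_gauss[OF q]) simp
    have e5: "q powi (6*r^2+5*r+1) * (q powi (int n - 3*r) * ?g (int n - 3*r)) = ?h r"
      by (rule powi_mult_gauss[OF q]) simp
    show ?thesis
      unfolding e1 e2 e3 powi_distrib e4 e5 by (simp only: algebra_simps)
  qed
  then have "(\<Sum>r\<in>{-M..M}. q powi (6*r^2+r) * gauss_binomial q (2*Suc n) (int (Suc n) - 3*r)
      - q powi (6*r^2+5*r+1) * gauss_binomial q (2*Suc n) (int (Suc n) - 3*r - 1)) =
     (\<Sum>r\<in>{-M..M}. q powi (6*r^2+r) * ?g (int n - 3*r) - q powi (6*r^2+5*r+1) * ?g (int n - 3*r - 1))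
      + (\<Sum>r\<in>{-M..M}. ?h (0 - r) - ?h r)"
    by (simp only: sum.distrib)
  also have "(\<Sum>r\<in>{-M..M}. ?h (0 - r)) = (\<Sum>r\<in>{-M..M}. ?h r)"
    by (rule sum_reflect_int) (use Suc.prems in \<open>auto simp del: gauss_binomial.simps intro!: gauss_binomial_eq_0\<close>)
  then have "(\<Sum>r\<in>{-M..M}. ?h (0 - r) - ?h r) = 0"
    unfolding sum_subtractf by simp
  also have "(\<Sum>r\<in>{-M..M}. q powi (6*r^2+r) * ?g (int n - 3*r) - q powi (6*r^2+5*r+1) * ?g (int n - 3*r - 1)) = 1"
    using theta_shift[OF q] Suc by simp
  finally show ?case by simp
qed

text \<open>The two binomials are expanded by different Pascal rules, so that the common term
  \<open>[2n, n-3r-1]\<close> cancels. What is left is \<open>q ^ n\<close> times the summand of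
  \<open>theta_eq_1\<close>, with its second part reflected by \<open>r -> -1 - r\<close>.\<close>

lemma theta_odd:
  fixes q :: "'a::field"
  assumes q: "q \<noteq> 0" and M: "int n + 3 \<le> M"
  shows "(\<Sum>r\<in>{-M..M}. q powi (6*r^2+4*r) *
      (gauss_binomial q (2*n+1) (int n - 3*r) - gauss_binomial q (2*n+1) (int n - 3*r - 1))) = q ^ n"
proof -
  let ?g = "gauss_binomial q (2*n)"
  let ?h = "\<lambda>r. q powi (6*r^2+4*r) * ?g (int n - 3*r - 1)"
  let ?k = "\<lambda>r. q powi (6*r^2+5*r+1) * ?g (int n - 3*r - 1)"
  have "q powi (6*r^2+4*r) * (gauss_binomial q (2*n+1) (int n - 3*r) - gauss_binomial q (2*n+1) (int n - 3*r - 1))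
    = q ^ n * (q powi (6*r^2+r) * ?g (int n - 3*r) - ?k (- 1 - r))" for r
  proof -
    have e1: "gauss_binomial q (2*n+1) (int n - 3*r) =
       q powi (int n - 3*r) * ?g (int n - 3*r) + ?g (int n - 3*r - 1)"
      using gauss_binomial.simps(2)[of q "2*n" "int n - 3*r"] by (simp add: algebra_simps)
    have e2: "gauss_binomial q (2*n+1) (int n - 3*r - 1) =
       q powi (int n + 2 + 3*r) * ?g (int n - 3*r - 2) + ?g (int n - 3*r - 1)"
      using gauss_binomial_Suc'[OF q, of "2*n" "int n - 3*r - 1"] by (simp add: algebra_simps)
    have e3: "?g (int n - 3*r - 2) = ?g (int n - 3*(- 1 - r) - 1)"
      using gauss_binomial_sym[OF q, of "2*n" "int n - 3*r - 2"] by (simp add: algebra_simps)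
    have "q powi (6*r^2+4*r) * (q powi (int n - 3*r) * ?g (int n - 3*r)) =
        q powi (int n + (6*r^2+r)) * ?g (int n - 3*r)"
      by (rule powi_mult_gauss[OF q]) simp
    then have e4: "q powi (6*r^2+4*r) * (q powi (int n - 3*r) * ?g (int n - 3*r)) =
        q ^ n * (q powi (6*r^2+r) * ?g (int n - 3*r))"
      using q by (simp add: power_int_add)
    have "q powi (6*r^2+4*r) * (q powi (int n + 2 + 3*r) * ?g (int n - 3*(- 1 - r) - 1)) =
       q powi (int n + (6*(- 1 - r)^2+5*(- 1 - r)+1)) * ?g (int n - 3*(- 1 - r) - 1)"
      by (rule powi_mult_gauss[OF q]) (simp add: power2_eq_square algebra_simps)
    also have "\<dots> = q ^ n * ?k (- 1 - r)"
      using power_int_add[of q "int n" "6*(- 1 - r)^2+5*(- 1 - r)+1"] q by (simp only: power_int_of_nat mult.assoc) simp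
    finally have e5: "q powi (6*r^2+4*r) * (q powi (int n + 2 + 3*r) * ?g (int n - 3*(- 1 - r) - 1)) = q ^ n * ?k (- 1 - r)" .
    show ?thesis
      unfolding e1 e2 e3 powi_distrib e4 e5 by (simp only: algebra_simps)
  qed
  then have "(\<Sum>r\<in>{-M..M}. q powi (6*r^2+4*r) *
      (gauss_binomial q (2*n+1) (int n - 3*r) - gauss_binomial q (2*n+1) (int n - 3*r - 1)))
    = q ^ n * (\<Sum>r\<in>{-M..M}. q powi (6*r^2+r) * ?g (int n - 3*r) - ?k (- 1 - r))"
    by (simp only: sum_distrib_left)
  also have "(\<Sum>r\<in>{-M..M}. ?k (- 1 - r)) = (\<Sum>r\<in>{-M..M}. ?k r)"
    by (rule sum_reflect_int) (use M in \<open>auto intro!: gauss_binomial_eq_0\<close>)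
  then have "(\<Sum>r\<in>{-M..M}. q powi (6*r^2+r) * ?g (int n - 3*r) - ?k (- 1 - r)) = 1"
    using theta_eq_1[OF q M] unfolding sum_subtractf by simp
  finally show ?thesis by simp
qed

section \<open>Folding the sum over all integers into Slater's sum over \<open>alpha\<close>\<close>

text \<open>Under \<open>t -> -1 - t\<close> the arguments \<open>3r\<close> and \<open>3r+1\<close>
  with \<open>r = -1 - M\<close> become \<open>3M+2\<close> and \<open>3M+1\<close>. So
  \<open>3M+1\<close> is reached twice, from \<open>r = M\<close> and from
  \<open>r = -1 - M\<close>, which explains the two terms of \<open>alpha\<close> in that residue
  class.\<close>

lemma sum_alpha_fold:
  fixes g :: "int \<Rightarrow> complex"
  assumes q: "q \<noteq> 0" and g: "\<And>t. g (- 1 - t) = g t"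
  shows "(\<Sum>k<3*M. alpha q k * g (int k)) =
    (\<Sum>r\<in>{-int M..<int M}. q powi (6*r^2+4*r) * (g (3*r) - g (3*r+1)))"
proof (induction M)
  case (Suc M)
  let ?f = "\<lambda>r. q powi (6*r^2+4*r) * (g (3*r) - g (3*r+1))"
  have "{-int (Suc M)..<int (Suc M)} = insert (- 1 - int M) (insert (int M) {-int M..<int M})"
    by auto
  then have "(\<Sum>r\<in>{-int (Suc M)..<int (Suc M)}. ?f r) = ?f (- 1 - int M) + ?f (int M) + (\<Sum>r\<in>{-int M..<int M}. ?f r)"
    by simp
  also have "?f (int M) = q powi (int (6*M^2+4*M)) * (g (3*int M) - g (3*int M+1))"
    by simp
  also have "\<dots> = q ^ (6*M^2+4*M) * (g (3*int M) - g (3*int M+1))"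
    by (simp only: power_int_of_nat)
  also have "?f (- 1 - int M) = q powi (6 * (int (Suc M))^2 - 4 * int (Suc M)) * (g (int (3*M+2)) - g (int (3*M+1)))"
    using g[of "int (3*M+2)"] g[of "int (3*M+1)"] by (simp add: power2_eq_square algebra_simps)
  also have "\<dots> = alpha q (3*M+2) * g (int (3*M+2)) - q powi (6 * (int (Suc M))^2 - 4 * int (Suc M)) * g (int (3*M+1))"
    using alpha_cases(1)[of "Suc M" q] by (simp add: algebra_simps)
  also have "6 * (int (Suc M))^2 - 4 * int (Suc M) = int (6*M^2+8*M+2)"
    by (simp add: power2_eq_square algebra_simps)
  also have "q powi \<dots> = q ^ (6*M^2+8*M+2)"
    by (simp only: power_int_of_nat)
  finally have "(\<Sum>r\<in>{-int (Suc M)..<int (Suc M)}. ?f r) =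
      alpha q (3*M+2) * g (int (3*M+2)) - q ^ (6*M^2+8*M+2) * g (int (3*M+1))
      + q ^ (6*M^2+4*M) * (g (3*int M) - g (3*int M+1)) + (\<Sum>k<3*M. alpha q k * g (int k))"
    unfolding Suc.IH .
  also have "\<dots> = (\<Sum>k<3*M. alpha q k * g (int k)) + alpha q (3*M) * g (int (3*M))
     + alpha q (3*M+1) * g (int (3*M+1)) + alpha q (3*M+2) * g (int (3*M+2))"
    unfolding alpha_cases(2,3) by (simp add: algebra_simps)
  also have "\<dots> = (\<Sum>k<3*Suc M. alpha q k * g (int k))"
    by (simp add: eval_nat_numeral)
  finally show ?case ..
qed simp

lemma sum_alpha_gauss_binomial:
  assumes q: "q \<noteq> 0"
  shows "(\<Sum>k\<le>n. alpha q k * gauss_binomial q (2*n+1) (int n - int k)) = q ^ n"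
proof -
  let ?g = "\<lambda>t. gauss_binomial q (2*n+1) (int n - t)"
  \<comment> \<open>Large enough for \<open>theta_odd\<close>; the terms with \<open>k > n\<close>
    and the extra endpoint \<open>r = M\<close> vanish.\<close>
  define M where "M = n + 4"
  have "?g (- 1 - t) = ?g t" for t
    using gauss_binomial_sym[OF q, of "2*n+1" "int n - t"] by (simp add: algebra_simps del: gauss_binomial.simps)
  note fold = sum_alpha_fold[where g = ?g, OF q this]
  have "(\<Sum>k\<le>n. alpha q k * ?g (int k)) = (\<Sum>k<3*M. alpha q k * ?g (int k))"
    by (rule sum.mono_neutral_left) (auto simp: M_def gauss_binomial_eq_0 simp del: gauss_binomial.simps)
  also have "\<dots> = (\<Sum>r\<in>{-int M..<int M}. q powi (6*r^2+4*r) * (?g (3*r) - ?g (3*r+1)))"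
    by (rule fold)
  also have "\<dots> = (\<Sum>r\<in>{-int M..int M}. q powi (6*r^2+4*r) * (?g (3*r) - ?g (3*r+1)))"
    by (rule sum.mono_neutral_left) (auto simp: M_def gauss_binomial_eq_0 simp del: gauss_binomial.simps)
  also have "\<dots> = q ^ n"
    using theta_odd[OF q, of n "int M"] by (simp add: M_def diff_diff_eq del: gauss_binomial.simps)
  finally show ?thesis .
qed

subsection \<open>Roots of unity\<close>

lemma primitive_root_nonzero: "primitive_root_of_unity N q \<Longrightarrow> q \<noteq> 0"
  by (auto simp: primitive_root_of_unity_def power_0_left split: if_splits)

lemma primitive_root_power_neq_1:
  "primitive_root_of_unity N q \<Longrightarrow> 0 < m \<Longrightarrow> m < N \<Longrightarrow> q ^ m \<noteq> 1"
  by (auto simp: primitive_root_of_unity_def)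

text \<open>The q-Lucas congruence below the first carry. For \<open>m = 0\<close> and
  \<open>0 < j < N\<close> the factor \<open>1 - q ^ N\<close> makes \<open>(q)_N\<close> zero while
  \<open>(q)_j\<close> and \<open>(q)_{N-j}\<close> are not; Pascal's rule then carries the equality
  to all \<open>m\<close>, as it never raises \<open>j\<close>.\<close>

lemma gauss_binomial_root_add:
  assumes root: "primitive_root_of_unity N q" and "j < int N"
  shows "gauss_binomial q (N + m) j = gauss_binomial q m j"
  using assms(2)
proof (induction m arbitrary: j)
  case 0
  show ?case
  proof (cases "j \<le> 0")
    case True
    then show ?thesis by (auto simp: gauss_binomial_eq_0 order.order_iff_strict)
  next
    case False
    then obtain k where k: "j = int k" "0 < k" "k < N"
      using 0 by (cases j) auto
    have "q * q ^ (N - 1) = 1"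
      using root k by (simp add: primitive_root_of_unity_def flip: power_Suc)
    then have "q_pochhammer q q N = 0"
      using q_pochhammer_Suc[of q q "N - 1"] k by simp
    then have "gauss_binomial q N j * (q_pochhammer q q k * q_pochhammer q q (N - k)) = 0"
      using gauss_binomial_q_pochhammer[OF primitive_root_nonzero[OF root], of "N - k" k] k by simp
    moreover have "q_pochhammer q q k \<noteq> 0" "q_pochhammer q q (N - k) \<noteq> 0"
      using q_pochhammer_root_neq_0[OF root] k by auto
    ultimately show ?thesis using k by simp
  qed
next
  case (Suc m)
  then show ?case by simp
qed

text \<open>As \<open>q ^ N = 1\<close>, the upper index \<open>N - 1 - d\<close> acts like
  \<open>-1 - d\<close>, and this is the q-analogue of \<open>C(-1-d, i) = (-1)^i C(d+i, i)\<close>.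
  Each induction step compares the ratios of consecutive coefficients on the two sides.\<close>

lemma gauss_binomial_root_reflect:
  assumes root: "primitive_root_of_unity N q" and "d + i < N"
  shows "q ^ (d * i + ((i + 1) choose 2)) * gauss_binomial q (N - 1 - d) (int i) =
    (- 1) ^ i * gauss_binomial q (d + i) (int i)"
  using assms(2)
proof (induction i)
  case 0
  then show ?case by (simp add: numeral_2_eq_2)
next
  case (Suc i)
  have q: "q \<noteq> 0" using primitive_root_nonzero[OF root] .
  let ?G = "gauss_binomial q (N - 1 - d)"
  \<comment> \<open>Allows the factor to be cancelled from both sides at the end.\<close>
  have nz: "1 - q ^ Suc i \<noteq> 0"
    using primitive_root_power_neq_1[OF root, of "Suc i"] Suc.prems by auto
  have step: "(1 - q ^ Suc i) * ?G (int (Suc i)) = (1 - q ^ (N - 1 - d - i)) * ?G (int i)"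
  proof -
    have "int (N - 1 - d) + 1 - int (Suc i) = int (N - 1 - d - i)"
      using Suc.prems by simp
    then show ?thesis
      using gauss_binomial_step[OF q, of "int (Suc i)" "N - 1 - d"]
      by (simp only: power_int_of_nat) simp
  qed
  have absorb: "(1 - q ^ Suc i) * gauss_binomial q (d + Suc i) (int (Suc i)) =
      (1 - q ^ (d + i + 1)) * gauss_binomial q (d + i) (int i)"
  proof -
    have "int (d + i) + 1 = int (d + i + 1)" by simp
    then show ?thesis
      using gauss_binomial_absorb[OF q, of "int (Suc i)" "d + i"]
      by (simp only: power_int_of_nat) (simp del: gauss_binomial.simps)
  qed
  have "d + i + 1 + (N - 1 - d - i) = N" using Suc.prems by simp
  then have "q ^ (d + i + 1) * q ^ (N - 1 - d - i) = 1"
    using root by (metis power_add primitive_root_of_unity_def)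
  then have flip: "q ^ (d + i + 1) * (1 - q ^ (N - 1 - d - i)) = - (1 - q ^ (d + i + 1))"
    by (simp add: right_diff_distrib)
  have "d * Suc i + ((Suc i + 1) choose 2) = (d * i + ((i + 1) choose 2)) + (d + i + 1)"
    by (simp add: numeral_2_eq_2)
  then have "(1 - q ^ Suc i) * (q ^ (d * Suc i + ((Suc i + 1) choose 2)) * ?G (int (Suc i)))
    = q ^ (d * i + ((i + 1) choose 2)) * q ^ (d + i + 1) * ((1 - q ^ Suc i) * ?G (int (Suc i)))"
    by (simp only: power_add mult_ac)
  also have "\<dots> = (q ^ (d + i + 1) * (1 - q ^ (N - 1 - d - i)))
      * (q ^ (d * i + ((i + 1) choose 2)) * ?G (int i))"
    unfolding step by (simp only: mult_ac)
  also have "q ^ (d * i + ((i + 1) choose 2)) * ?G (int i) = (- 1) ^ i * gauss_binomial q (d + i) (int i)"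
    using Suc by simp
  also have "(q ^ (d + i + 1) * (1 - q ^ (N - 1 - d - i))) * ((- 1) ^ i * gauss_binomial q (d + i) (int i))
     = (- 1) ^ Suc i * ((1 - q ^ (d + i + 1)) * gauss_binomial q (d + i) (int i))"
    unfolding flip by (simp add: algebra_simps)
  also have "\<dots> = (1 - q ^ Suc i) * ((- 1) ^ Suc i * gauss_binomial q (d + Suc i) (int (Suc i)))"
    unfolding absorb[symmetric] by (simp only: mult_ac)
  finally show ?case
    using nz by (simp del: gauss_binomial.simps power_Suc)
qed

section \<open>Inverse Bailey rows at a root of unity\<close>

text \<open>Generically \<open>[k, n] (q^{k+1})_n\<close> is
  \<open>(q)_{k+n} / ((q)_{k-n} (q)_n)\<close>, the usual inverse Bailey entry up to a row factor
  and the column factor \<open>1 / (q)_n\<close>; this form has no denominators. For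
  \<open>n > k\<close> the truncated \<open>k - n\<close> is harmless since the Gaussian binomial is
  0.\<close>

definition bailey_weight :: "complex \<Rightarrow> nat \<Rightarrow> nat \<Rightarrow> complex" where
  "bailey_weight q k n = (- 1) ^ (k - n) * q ^ ((k - n) choose 2) * gauss_binomial q k (int n) *
     q_pochhammer (q ^ (k + 1)) q n"

text \<open>Both sides are \<open>(q)_{2j+i} / ((q)_j (q)_i)\<close>. Only \<open>(q)_j\<close> and
  \<open>(q)_i\<close> are cancelled, because \<open>(q)_{2j}\<close> may vanish.\<close>

lemma gauss_binomial_mult_q_pochhammer:
  assumes root: "primitive_root_of_unity N q" and "j + i < N"
  shows "gauss_binomial q (j + i) (int j) * q_pochhammer (q ^ (j + i + 1)) q j =
    gauss_binomial q (2 * j + i) (int i) * q_pochhammer (q ^ (j + 1)) q j"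
proof -
  have q: "q \<noteq> 0" using primitive_root_nonzero[OF root] .
  let ?P = "q_pochhammer q q"
  have nz: "?P j \<noteq> 0" "?P i \<noteq> 0"
    using q_pochhammer_root_neq_0[OF root] assms(2) by auto
  have 1: "gauss_binomial q (j + i) (int j) * (?P j * ?P i) = ?P (j + i)"
    using gauss_binomial_q_pochhammer[OF q, of i j] by (simp add: add.commute)
  have 2: "gauss_binomial q (2 * j + i) (int i) * (?P i * ?P (2 * j)) = ?P (2 * j + i)"
    by (rule gauss_binomial_q_pochhammer[OF q])
  have 3: "?P (2 * j) = ?P j * q_pochhammer (q ^ (j + 1)) q j"
    using q_pochhammer_add[of q q j j] by (simp add: mult_2)
  have 4: "?P (2 * j + i) = ?P (j + i) * q_pochhammer (q ^ (j + i + 1)) q j"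
    using q_pochhammer_add[of q q "j + i" j] by (simp add: mult_2 add_ac)
  have "(gauss_binomial q (j + i) (int j) * q_pochhammer (q ^ (j + i + 1)) q j) * (?P j * ?P i)
    = (gauss_binomial q (2 * j + i) (int i) * q_pochhammer (q ^ (j + 1)) q j) * (?P j * ?P i)"
    using 1 2 unfolding 3 4 by (metis mult.assoc mult.commute)
  then show ?thesis using nz by simp
qed

lemma bailey_weight_root:
  assumes root: "primitive_root_of_unity N q" and k: "k < N" and j: "j < N"
  shows "q powi (1 - (int k)\<^sup>2) * bailey_weight q k j =
    q_pochhammer (q ^ (j + 1)) q j * q powi (1 - (int j)\<^sup>2) *
    gauss_binomial q (2 * (N - 1 - j) + 1) (int (N - 1 - j) - int k)"
proof -
  have q: "q \<noteq> 0" using primitive_root_nonzero[OF root] .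
  consider "2 * j \<ge> N" | "2 * j < N" "k < j" | "2 * j < N" "N \<le> k + j" | "j \<le> k" "k + j < N"
    by linarith
  then show ?thesis
  proof cases
    \<comment> \<open>Both Pochhammer symbols contain the factor \<open>1 - q ^ N\<close>, unless
      \<open>k < j\<close>, when the weight vanishes through its binomial.\<close>
    case 1
    have "q_pochhammer (q ^ (j + 1)) q j = 0"
    proof -
      have "q ^ (j + 1) * q ^ (N - j - 1) = 1"
        using root j by (simp add: primitive_root_of_unity_def flip: power_add power_Suc)
      then show ?thesis
        unfolding q_pochhammer_def using 1 j by (intro prod_zero bexI[of _ "N - j"]) auto
    qed
    moreover have "bailey_weight q k j = 0"
    proof (cases "j \<le> k")
      case True
      have "q ^ (k + 1) * q ^ (N - k - 1) = 1"
        using root k by (simp add: primitive_root_of_unity_def flip: power_add power_Suc)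
      then have "q_pochhammer (q ^ (k + 1)) q j = 0"
        unfolding q_pochhammer_def using True 1 k by (intro prod_zero bexI[of _ "N - k"]) auto
      then show ?thesis by (simp add: bailey_weight_def)
    qed (simp add: bailey_weight_def gauss_binomial_eq_0)
    ultimately show ?thesis by simp
  next
    \<comment> \<open>The q-Lucas congruence reduces the upper index to \<open>N - 1 - 2j\<close>,
      below the lower index \<open>N - 1 - j - k\<close>.\<close>
    case 2
    have eq: "2 * (N - 1 - j) + 1 = N + (N - 1 - 2 * j)" using 2 j by simp
    have "gauss_binomial q (2 * (N - 1 - j) + 1) (int (N - 1 - j) - int k) = 0"
      unfolding eq using gauss_binomial_root_add[OF root] 2 j
      by (subst gauss_binomial_root_add[OF root]) (auto intro!: gauss_binomial_eq_0 simp: of_nat_diff)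
    with 2 show ?thesis by (simp add: bailey_weight_def gauss_binomial_eq_0 del: gauss_binomial.simps)
  next
    \<comment> \<open>The lower index on the right is negative, and on the left
      \<open>1 - q ^ N\<close> is a factor of \<open>(q^{k+1})_j\<close>.\<close>
    case 3
    have "q ^ (k + 1) * q ^ (N - k - 1) = 1"
      using root k by (simp add: primitive_root_of_unity_def flip: power_add power_Suc)
    then have "q_pochhammer (q ^ (k + 1)) q j = 0"
      unfolding q_pochhammer_def using 3 k by (intro prod_zero bexI[of _ "N - k"]) auto
    with 3 j show ?thesis by (simp add: bailey_weight_def gauss_binomial_eq_0 of_nat_diff del: gauss_binomial.simps)
  next
    \<comment> \<open>The main case: q-Lucas, symmetry, then reflection with \<open>d = 2j\<close>.
      The powers of \<open>q\<close> combine to \<open>i^2 + 2ij = k^2 - j^2\<close>, which turns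
      \<open>1 - k^2\<close> into \<open>1 - j^2\<close>.\<close>
    case 4
    define i where "i = k - j"
    have i: "k = j + i" "2 * j + i < N" using 4 by (auto simp: i_def)
    have eq: "2 * (N - 1 - j) + 1 = N + (N - 1 - 2 * j)" using i by simp
    let ?s = "2 * j * i + ((i + 1) choose 2)"
    have "gauss_binomial q (2 * (N - 1 - j) + 1) (int (N - 1 - j) - int k) =
      gauss_binomial q (N - 1 - 2 * j) (int (N - 1 - j) - int k)"
      unfolding eq using i by (intro gauss_binomial_root_add[OF root]) auto
    also have "\<dots> = gauss_binomial q (N - 1 - 2 * j) (int i)"
    proof -
      have "int (N - 1 - j) - int k = int (N - 1 - 2 * j) - int i" using i by simp
      then show ?thesis by (simp only: gauss_binomial_sym[OF q])
    qed
    finally have G: "gauss_binomial q (2 * (N - 1 - j) + 1) (int (N - 1 - j) - int k) =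
      gauss_binomial q (N - 1 - 2 * j) (int i)" .
    have "bailey_weight q k j = q ^ (i choose 2) * ((- 1) ^ i * gauss_binomial q (2 * j + i) (int i)) * q_pochhammer (q ^ (j + 1)) q j"
      using gauss_binomial_mult_q_pochhammer[OF root, of j i] i
      by (simp add: bailey_weight_def i(1) mult_ac)
    also have "\<dots> = q ^ (i choose 2) * (q ^ ?s * gauss_binomial q (N - 1 - 2 * j) (int i)) * q_pochhammer (q ^ (j + 1)) q j"
      unfolding gauss_binomial_root_reflect[OF root i(2)] by (simp add: mult_ac)
    also have "\<dots> = q ^ ((i choose 2) + ?s) * (gauss_binomial q (N - 1 - 2 * j) (int i) * q_pochhammer (q ^ (j + 1)) q j)"
      by (simp add: power_add)
    also have "(i choose 2) + ?s = i\<^sup>2 + 2 * j * i"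
    proof -
      have "(i choose 2) + ((i + 1) choose 2) = i\<^sup>2"
        by (induction i) (auto simp: numeral_2_eq_2 algebra_simps)
      then show ?thesis by simp
    qed
    also have "q ^ (i\<^sup>2 + 2 * j * i) = q powi int (i\<^sup>2 + 2 * j * i)"
      by (simp only: power_int_of_nat)
    finally have "q powi (1 - (int k)\<^sup>2) * bailey_weight q k j =
      q powi (1 - (int k)\<^sup>2) * (q powi int (i\<^sup>2 + 2 * j * i) *
       (gauss_binomial q (N - 1 - 2 * j) (int i) * q_pochhammer (q ^ (j + 1)) q j))"
      by simp
    also have "\<dots> = q powi (1 - (int j)\<^sup>2) *
       (gauss_binomial q (N - 1 - 2 * j) (int i) * q_pochhammer (q ^ (j + 1)) q j)"
      by (rule powi_mult_gauss[OF q]) (simp add: i(1) power2_eq_square algebra_simps)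
    finally show ?thesis unfolding G by (simp add: mult_ac)
  qed
qed

text \<open>The right-hand side is the weight that \<open>H7\<close> gives to tuples with top entry
  \<open>j\<close>. Slater's identity contributes \<open>q ^ (N - 1 - j)\<close>, that is
  \<open>q powi (- 1 - j)\<close>, which joins the prefactor
  \<open>q powi (1 - j^2)\<close>.\<close>

lemma sum_alpha_bailey_weight:
  assumes root: "primitive_root_of_unity N q" and j: "j < N"
  shows "(\<Sum>k<N. q powi (1 - (int k)\<^sup>2) * alpha q k * bailey_weight q k j) =
    q powi (- (int j)\<^sup>2 - int j) * q_pochhammer (q ^ (j + 1)) q j"
proof -
  have q: "q \<noteq> 0" using primitive_root_nonzero[OF root] .
  define n where "n = N - 1 - j"
  let ?c = "q_pochhammer (q ^ (j + 1)) q j * q powi (1 - (int j)\<^sup>2)"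
  have "(\<Sum>k<N. q powi (1 - (int k)\<^sup>2) * alpha q k * bailey_weight q k j) =
    (\<Sum>k<N. ?c * (alpha q k * gauss_binomial q (2 * n + 1) (int n - int k)))"
  proof (intro sum.cong refl)
    fix k assume "k \<in> {..<N}"
    then have "q powi (1 - (int k)\<^sup>2) * bailey_weight q k j =
        ?c * gauss_binomial q (2 * n + 1) (int n - int k)"
      unfolding n_def by (intro bailey_weight_root[OF root _ j]) simp
    then show "q powi (1 - (int k)\<^sup>2) * alpha q k * bailey_weight q k j =
        ?c * (alpha q k * gauss_binomial q (2 * n + 1) (int n - int k))"
      by (metis mult.assoc mult.commute)
  qed
  also have "\<dots> = ?c * (\<Sum>k<N. alpha q k * gauss_binomial q (2 * n + 1) (int n - int k))"
    by (rule sum_distrib_left[symmetric])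
  also have "(\<Sum>k<N. alpha q k * gauss_binomial q (2 * n + 1) (int n - int k)) =
     (\<Sum>k\<le>n. alpha q k * gauss_binomial q (2 * n + 1) (int n - int k))"
    using j by (intro sum.mono_neutral_right) (auto simp: n_def gauss_binomial_eq_0 simp del: gauss_binomial.simps)
  also have "\<dots> = q ^ n"
    by (rule sum_alpha_gauss_binomial[OF q])
  also have "q ^ n = q powi (- 1 - int j)"
  proof -
    have "q ^ n * q ^ (j + 1) = 1"
      using root j by (simp add: n_def primitive_root_of_unity_def flip: power_add power_Suc)
    moreover have "q powi (- 1 - int j) * q ^ (j + 1) = 1"
      using q by (simp add: power_int_diff power_int_minus field_simps)
    ultimately show ?thesis
      using q by (metis mult_right_cancel power_not_zero)
  qed
  also have "?c * q powi (- 1 - int j) = q_pochhammer (q ^ (j + 1)) q j * (q powi (1 - (int j)\<^sup>2) * q powi (- 1 - int j))"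
    by simp
  also have "q powi (1 - (int j)\<^sup>2) * q powi (- 1 - int j) = q powi (- (int j)\<^sup>2 - int j)"
    using q by (simp flip: power_int_add)
  finally show ?thesis by (simp add: mult.commute)
qed

subsection \<open>The Bailey chain\<close>

text \<open>Both sides are the q-trinomial \<open>(q)_{m+r} / ((q)_m (q)_i (q)_{r-i})\<close>; the
  bound \<open>m + r < N\<close> makes the cancelled factors nonzero.\<close>

lemma gauss_binomial_trinomial:
  assumes root: "primitive_root_of_unity N q" and "m + r < N" and "i \<le> r"
  shows "gauss_binomial q (m + r) (int (m + i)) * gauss_binomial q (m + i) (int m) =
    gauss_binomial q (m + r) (int m) * gauss_binomial q r (int i)"
proof -
  have q: "q \<noteq> 0" using primitive_root_nonzero[OF root] .
  let ?P = "q_pochhammer q q"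
  have nz: "?P m \<noteq> 0" "?P i \<noteq> 0" "?P (r - i) \<noteq> 0" "?P (m + i) \<noteq> 0" "?P r \<noteq> 0"
    using q_pochhammer_root_neq_0[OF root] assms(2,3) by auto
  have a: "gauss_binomial q (m + r) (int (m + i)) * (?P (m + i) * ?P (r - i)) = ?P (m + r)"
    using gauss_binomial_q_pochhammer[OF q, of "r - i" "m + i"] assms(3) by (simp add: add.commute)
  have b: "gauss_binomial q (m + i) (int m) * (?P m * ?P i) = ?P (m + i)"
    using gauss_binomial_q_pochhammer[OF q, of i m] by (simp add: add.commute)
  have c: "gauss_binomial q (m + r) (int m) * (?P m * ?P r) = ?P (m + r)"
    using gauss_binomial_q_pochhammer[OF q, of r m] by (simp add: add.commute)
  have d: "gauss_binomial q r (int i) * (?P i * ?P (r - i)) = ?P r"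
    using gauss_binomial_q_pochhammer[OF q, of "r - i" i] assms(3) by simp
  have
    "(gauss_binomial q (m + r) (int (m + i)) * gauss_binomial q (m + i) (int m)) * (?P m * ?P i * ?P (r - i)) =
     gauss_binomial q (m + r) (int (m + i)) * ((gauss_binomial q (m + i) (int m) * (?P m * ?P i)) * ?P (r - i))"
    by (simp only: mult_ac)
  also have "\<dots> = gauss_binomial q (m + r) (int m) * (?P m * ?P r)"
    unfolding b a c ..
  also have "\<dots> = (gauss_binomial q (m + r) (int m) * gauss_binomial q r (int i)) * (?P m * ?P i * ?P (r - i))"
    unfolding d[symmetric] by (simp only: mult_ac)
  finally have
    "(gauss_binomial q (m + r) (int (m + i)) * gauss_binomial q (m + i) (int m)) * (?P m * ?P i * ?P (r - i)) =
     (gauss_binomial q (m + r) (int m) * gauss_binomial q r (int i)) * (?P m * ?P i * ?P (r - i))" .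
  then show ?thesis using nz by simp
qed

text \<open>The eigenvector property. With \<open>n = m + i\<close> the trinomial identity pulls out
  \<open>[k, m]\<close> and the Pochhammer symbol splits after \<open>m\<close> factors, leaving
  \<open>q_vandermonde\<close> at \<open>x = q^(k+1+m)\<close>. The eigenvalue arises from
  \<open>m^2 + m + (k+1+m)(k-m) = k^2 + k\<close>.\<close>

lemma sum_bailey_weight_gauss_binomial:
  assumes root: "primitive_root_of_unity N q" and "k < N" and "m \<le> k"
  shows "(\<Sum>n\<le>k. bailey_weight q k n * (q ^ (m\<^sup>2 + m) * gauss_binomial q n (int m))) =
    q ^ (k\<^sup>2 + k) * bailey_weight q k m"
proof -
  obtain r where r: "k = m + r" using assms(3) le_Suc_ex by blast
  let ?c = "q ^ (m\<^sup>2 + m) * gauss_binomial q k (int m) * q_pochhammer (q ^ (k + 1)) q m"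
  let ?x = "q ^ (k + 1) * q ^ m"
  have "(\<Sum>n\<le>k. bailey_weight q k n * (q ^ (m\<^sup>2 + m) * gauss_binomial q n (int m))) =
    (\<Sum>n\<in>{m..k}. bailey_weight q k n * (q ^ (m\<^sup>2 + m) * gauss_binomial q n (int m)))"
    by (rule sum.mono_neutral_right) (auto simp: gauss_binomial_eq_0)
  also have "\<dots> = (\<Sum>i\<le>r. ?c * ((- 1) ^ (r - i) * q ^ ((r - i) choose 2) * gauss_binomial q r (int i) * q_pochhammer ?x q i))"
  proof (rule sum.reindex_bij_witness[where i = "\<lambda>i. m + i" and j = "\<lambda>n. n - m"])
    fix n assume "n \<in> {m..k}"
    then obtain i where i: "n = m + i" "i \<le> r"
      using r by (metis atLeastAtMost_iff le_Suc_ex nat_add_left_cancel_le)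
    have "bailey_weight q k n * (q ^ (m\<^sup>2 + m) * gauss_binomial q n (int m)) =
       (- 1) ^ (r - i) * q ^ ((r - i) choose 2) * q ^ (m\<^sup>2 + m) *
       (gauss_binomial q (m + r) (int (m + i)) * gauss_binomial q (m + i) (int m)) *
       (q_pochhammer (q ^ (k + 1)) q m * q_pochhammer ?x q i)"
      by (simp add: bailey_weight_def i r q_pochhammer_add mult_ac)
    also have "\<dots> = ?c * ((- 1) ^ (r - i) * q ^ ((r - i) choose 2) * gauss_binomial q r (int i) * q_pochhammer ?x q i)"
      unfolding gauss_binomial_trinomial[OF root assms(2)[unfolded r] i(2)] by (simp add: r mult_ac)
    finally have "?c * ((- 1) ^ (r - i) * q ^ ((r - i) choose 2) * gauss_binomial q r (int i) * q_pochhammer ?x q i) =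
       bailey_weight q k n * (q ^ (m\<^sup>2 + m) * gauss_binomial q n (int m))"
      by (rule sym)
    then show "?c * ((- 1) ^ (r - (n - m)) * q ^ ((r - (n - m)) choose 2) * gauss_binomial q r (int (n - m)) * q_pochhammer ?x q (n - m)) =
       bailey_weight q k n * (q ^ (m\<^sup>2 + m) * gauss_binomial q n (int m))"
      by (simp only: i(1) add_diff_cancel_left')
  qed (auto simp: r)
  also have "\<dots> = ?c * ((- 1) ^ r * q ^ (r choose 2) * ?x ^ r)"
    by (simp only: sum_distrib_left[symmetric] q_vandermonde)
  also have "\<dots> = (q ^ (m\<^sup>2 + m) * ?x ^ r) * bailey_weight q k m"
    by (simp add: bailey_weight_def r)
  also have "q ^ (m\<^sup>2 + m) * ?x ^ r = q ^ (k\<^sup>2 + k)"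
  proof -
    have "m\<^sup>2 + m + (k + 1 + m) * r = k\<^sup>2 + k"
      unfolding r by (simp add: power2_eq_square algebra_simps)
    then show ?thesis
      by (metis power_add power_mult)
  qed
  finally show ?thesis .
qed

text \<open>The vector \<open>T^p \<delta>_0\<close>. The first application of \<open>T\<close>
  gives the constant 1, so \<open>p\<close> applications match the \<open>p - 1\<close> binomials of
  a term of \<open>H7\<close>.\<close>

fun bailey_chain :: "complex \<Rightarrow> nat \<Rightarrow> nat \<Rightarrow> complex" where
  "bailey_chain q 0 n = (if n = 0 then 1 else 0)"
| "bailey_chain q (Suc p) n =
     (\<Sum>m\<le>n. q ^ (m\<^sup>2 + m) * gauss_binomial q n (int m) * bailey_chain q p m)"

text \<open>Each application of \<open>T\<close> yields one eigenvalue; at the end the delta picks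
  the entry of the row in column 0.\<close>

lemma sum_bailey_weight_chain:
  assumes root: "primitive_root_of_unity N q" and k: "k < N"
  shows "(\<Sum>n\<le>k. bailey_weight q k n * bailey_chain q p n) =
    q ^ (p * (k\<^sup>2 + k)) * ((- 1) ^ k * q ^ (k choose 2))"
proof (induction p)
  case 0
  have "(\<Sum>n\<le>k. bailey_weight q k n * bailey_chain q 0 n) = (\<Sum>n\<le>k. if n = 0 then bailey_weight q k 0 else 0)"
    by (intro sum.cong) auto
  then show ?case by (simp add: bailey_weight_def)
next
  case (Suc p)
  have "(\<Sum>n\<le>k. bailey_weight q k n * bailey_chain q (Suc p) n) =
    (\<Sum>n\<le>k. \<Sum>m\<le>k. bailey_weight q k n * (q ^ (m\<^sup>2 + m) * gauss_binomial q n (int m)) * bailey_chain q p m)"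
  proof (intro sum.cong refl)
    fix n assume "n \<in> {..k}"
    then have "bailey_chain q (Suc p) n = (\<Sum>m\<le>k. q ^ (m\<^sup>2 + m) * gauss_binomial q n (int m) * bailey_chain q p m)"
      unfolding bailey_chain.simps by (intro sum.mono_neutral_left) (auto simp: gauss_binomial_eq_0)
    then show "bailey_weight q k n * bailey_chain q (Suc p) n =
      (\<Sum>m\<le>k. bailey_weight q k n * (q ^ (m\<^sup>2 + m) * gauss_binomial q n (int m)) * bailey_chain q p m)"
      by (simp add: sum_distrib_left mult.assoc)
  qed
  also have "\<dots> = (\<Sum>m\<le>k. (\<Sum>n\<le>k. bailey_weight q k n * (q ^ (m\<^sup>2 + m) * gauss_binomial q n (int m))) * bailey_chain q p m)"
    by (subst sum.swap) (simp add: sum_distrib_right)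
  also have "\<dots> = (\<Sum>m\<le>k. q ^ (k\<^sup>2 + k) * (bailey_weight q k m * bailey_chain q p m))"
    by (intro sum.cong refl) (simp add: sum_bailey_weight_gauss_binomial[OF root k])
  also have "\<dots> = q ^ (k\<^sup>2 + k) * (\<Sum>m\<le>k. bailey_weight q k m * bailey_chain q p m)"
    by (rule sum_distrib_left[symmetric])
  finally show ?case
    unfolding Suc.IH by (simp add: power_add algebra_simps)
qed

section \<open>The sum over tuples as an iterated operator\<close>

lemma gauss_binomial_eq_q_binomial:
  assumes root: "primitive_root_of_unity N q" and "k \<le> n" and "n < N"
  shows "gauss_binomial q n (int k) = q_binomial q n k"
proof -
  have "gauss_binomial q n (int k) * (q_pochhammer q q k * q_pochhammer q q (n - k)) = q_pochhammer q q n"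
    using gauss_binomial_q_pochhammer[OF primitive_root_nonzero[OF root], of "n - k" k] assms(2) by simp
  moreover have "q_pochhammer q q k \<noteq> 0" "q_pochhammer q q (n - k) \<noteq> 0"
    using q_pochhammer_root_neq_0[OF root] assms(2,3) by auto
  ultimately show ?thesis
    unfolding q_binomial_def by (simp add: field_simps)
qed

definition tuples_ending :: "nat \<Rightarrow> nat \<Rightarrow> (nat \<Rightarrow> nat) set" where
  "tuples_ending p x = {n \<in> index_tuples p. n p = x}"

lemma finite_tuples_ending: "finite (tuples_ending p x)"
proof (rule finite_subset)
  show "tuples_ending p x \<subseteq> {1..p} \<rightarrow>\<^sub>E {..x}"
    using index_tuples_le[of _ p] by (auto simp: tuples_ending_def index_tuples_def PiE_iff extensional_def)
qed (intro finite_PiE; simp)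

lemma index_tuples_SucI:
  assumes "s \<in> index_tuples p" and "p \<ge> 1" and "s p \<le> x"
  shows "s(Suc p := x) \<in> index_tuples (Suc p)"
  unfolding index_tuples_def
proof (intro CollectI conjI ballI)
  show "s(Suc p := x) \<in> {1..Suc p} \<rightarrow>\<^sub>E UNIV"
    using assms(1) by (auto simp: index_tuples_def PiE_def extensional_def)
  show "(s(Suc p := x)) i \<le> (s(Suc p := x)) (i + 1)" if "i \<in> {1..<Suc p}" for i
    using assms that by (cases "i = p") (auto simp: index_tuples_def)
qed

text \<open>Removing the top entry \<open>x\<close> of a tuple leaves a tuple ending in some
  \<open>m \<le> x\<close>, which is the recursion of \<open>bailey_chain\<close>. The bound
  \<open>x < N\<close> makes every \<open>q_binomial\<close> involved a genuine Gaussian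
  binomial.\<close>

lemma sum_tuples_ending_eq_bailey_chain:
  assumes root: "primitive_root_of_unity N q" and "p \<ge> 1" and "x < N"
  shows "(\<Sum>n\<in>tuples_ending p x. \<Prod>i = 1..p - 1. q ^ ((n i)\<^sup>2 + n i) * q_binomial q (n (i + 1)) (n i)) =
    bailey_chain q p x"
  using assms(2,3)
proof (induction p arbitrary: x rule: nat_induct_at_least)
  case base
  have "tuples_ending 1 x = {(\<lambda>i. undefined)(1 := x)}"
    by (auto simp: tuples_ending_def index_tuples_def PiE_def extensional_def fun_eq_iff)
  moreover have "(\<Sum>m\<le>x. q ^ (m\<^sup>2 + m) * gauss_binomial q x (int m) * bailey_chain q 0 m) = (\<Sum>m\<le>x. if m = 0 then 1 else 0)"
    by (intro sum.cong) auto
  ultimately show ?case by simp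
next
  case (Suc p)
  let ?F = "\<lambda>n i. q ^ ((n i)\<^sup>2 + n i) * q_binomial q (n (i + 1)) (n i)"
  have "(\<Sum>n\<in>tuples_ending (Suc p) x. \<Prod>i = 1..Suc p - 1. ?F n i) =
    (\<Sum>(m, s)\<in>(SIGMA m:{..x}. tuples_ending p m). q ^ (m\<^sup>2 + m) * q_binomial q x m * (\<Prod>i = 1..p - 1. ?F s i))"
  \<comment> \<open>The restriction resets position \<open>p + 1\<close> to
    \<open>undefined\<close>, as membership in \<open>index_tuples p\<close> demands.\<close>
  proof (rule sum.reindex_bij_witness[where i = "\<lambda>(m, s). s(Suc p := x)" and j = "\<lambda>n. (n p, restrict n {1..p})"])
    fix n assume n: "n \<in> tuples_ending (Suc p) x"
    then have ext: "n \<in> extensional {1..Suc p}" and x: "n (Suc p) = x"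
      and mono: "\<And>i. i \<in> {1..<Suc p} \<Longrightarrow> n i \<le> n (i + 1)"
      by (auto simp: tuples_ending_def index_tuples_def PiE_def)
    show "(case (n p, restrict n {1..p}) of (m, s) \<Rightarrow> s(Suc p := x)) = n"
      using ext x by (auto simp: fun_eq_iff extensional_def)
    show "(n p, restrict n {1..p}) \<in> (SIGMA m:{..x}. tuples_ending p m)"
      using mono[of p] mono x Suc.hyps by (auto simp: tuples_ending_def index_tuples_def)
    have "{1..p} = insert p {1..p - 1}" using Suc.hyps by auto
    moreover have "(\<Prod>i = 1..p - 1. ?F (restrict n {1..p}) i) = (\<Prod>i = 1..p - 1. ?F n i)"
      by (intro prod.cong) auto
    ultimately show "(case (n p, restrict n {1..p}) of (m, s) \<Rightarrow>
        q ^ (m\<^sup>2 + m) * q_binomial q x m * (\<Prod>i = 1..p - 1. ?F s i)) = (\<Prod>i = 1..Suc p - 1. ?F n i)"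
      using x Suc.hyps by simp
  next
    fix ms assume "ms \<in> (SIGMA m:{..x}. tuples_ending p m)"
    then obtain m s where ms: "ms = (m, s)" "m \<le> x" "s \<in> index_tuples p" "s p = m"
      by (auto simp: tuples_ending_def)
    have ext: "s \<in> extensional {1..p}" using ms by (auto simp: index_tuples_def PiE_def)
    show "(case ms of (m, s) \<Rightarrow> s(Suc p := x)) \<in> tuples_ending (Suc p) x"
      using index_tuples_SucI[of s p x] ms Suc.hyps by (simp add: tuples_ending_def)
    have "restrict (s(Suc p := x)) {1..p} = s"
      using ext by (auto simp: fun_eq_iff extensional_def)
    then show "((case ms of (m, s) \<Rightarrow> s(Suc p := x)) p, restrict (case ms of (m, s) \<Rightarrow> s(Suc p := x)) {1..p}) = ms"
      using ms by simp
  qed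
  also have "\<dots> = (\<Sum>m\<le>x. \<Sum>s\<in>tuples_ending p m. q ^ (m\<^sup>2 + m) * q_binomial q x m * (\<Prod>i = 1..p - 1. ?F s i))"
    by (rule sum.Sigma[symmetric]) (auto simp: finite_tuples_ending)
  also have "\<dots> = (\<Sum>m\<le>x. q ^ (m\<^sup>2 + m) * gauss_binomial q x (int m) * bailey_chain q p m)"
  proof (intro sum.cong refl)
    fix m assume m: "m \<in> {..x}"
    have "(\<Sum>s\<in>tuples_ending p m. \<Prod>i = 1..p - 1. ?F s i) = bailey_chain q p m"
      using Suc.IH[of m] Suc.prems m by simp
    moreover have "q_binomial q x m = gauss_binomial q x (int m)"
      using gauss_binomial_eq_q_binomial[OF root, of m x] Suc.prems m by simp
    ultimately show "(\<Sum>s\<in>tuples_ending p m. q ^ (m\<^sup>2 + m) * q_binomial q x m * (\<Prod>i = 1..p - 1. ?F s i)) =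
       q ^ (m\<^sup>2 + m) * gauss_binomial q x (int m) * bailey_chain q p m"
      by (simp only: sum_distrib_left[symmetric])
  qed
  finally show ?case by (simp only: bailey_chain.simps)
qed

text \<open>Terms with top entry at least \<open>N\<close> vanish, so the sum is finite and can be
  grouped by the top entry, on which the outer factor alone depends.\<close>

lemma H7_eq_sum_bailey_chain:
  assumes root: "primitive_root_of_unity N q" and p: "p \<ge> 1"
  shows "H7 p q = (\<Sum>x<N. q powi (- (int x)\<^sup>2 - int x) * q_pochhammer (q ^ (x + 1)) q x * bailey_chain q p x)"
proof -
  let ?T = "\<Union>x<N. tuples_ending p x"
  have "H7 p q = (\<Sum>\<^sub>\<infinity>n\<in>?T. H7_term p q n)"
    unfolding H7_def
  proof (rule infsum_cong_neutral)
    fix n assume "n \<in> index_tuples p - ?T"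
    then have "N \<le> n p" by (auto simp: tuples_ending_def)
    then show "H7_term p q n = 0"
      using q_pochhammer_root_eq_0[OF root] by (simp add: H7_term_def)
  qed (auto simp: tuples_ending_def)
  also have "\<dots> = (\<Sum>n\<in>?T. H7_term p q n)"
    by (rule infsum_finite) (auto simp: finite_tuples_ending)
  also have "\<dots> = (\<Sum>x<N. \<Sum>n\<in>tuples_ending p x. H7_term p q n)"
    by (rule sum.UNION_disjoint) (auto simp: finite_tuples_ending, auto simp: tuples_ending_def)
  also have "\<dots> = (\<Sum>x<N. q powi (- (int x)\<^sup>2 - int x) * q_pochhammer (q ^ (x + 1)) q x * bailey_chain q p x)"
  proof (intro sum.cong refl)
    fix x assume "x \<in> {..<N}"
    then have "bailey_chain q p x =
      (\<Sum>n\<in>tuples_ending p x. \<Prod>i = 1..p - 1. q ^ ((n i)\<^sup>2 + n i) * q_binomial q (n (i + 1)) (n i))"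
      using sum_tuples_ending_eq_bailey_chain[OF root p] by simp
    moreover have "(\<Sum>n\<in>tuples_ending p x. H7_term p q n) =
      (\<Sum>n\<in>tuples_ending p x. q powi (- (int x)\<^sup>2 - int x) * q_pochhammer (q ^ (x + 1)) q x *
        (\<Prod>i = 1..p - 1. q ^ ((n i)\<^sup>2 + n i) * q_binomial q (n (i + 1)) (n i)))"
      by (intro sum.cong refl) (auto simp: H7_term_def tuples_ending_def)
    ultimately show "(\<Sum>n\<in>tuples_ending p x. H7_term p q n) =
      q powi (- (int x)\<^sup>2 - int x) * q_pochhammer (q ^ (x + 1)) q x * bailey_chain q p x"
      by (simp only: sum_distrib_left[symmetric])
  qed
  finally show ?thesis .
qed

theorem theorem2p8:
  fixes p N :: nat and q :: complex
  assumes "p \<ge> 1" and "N \<ge> 1" and "primitive_root_of_unity N q"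
  shows "H7 p q =
    q * (\<Sum>k = 0..N - 1. (- 1) ^ k * q ^ (((k + 1) choose 2) + (p - 1) * (k\<^sup>2 + k)) * alpha q k)"
proof -
  note root = assms(3)
  have q: "q \<noteq> 0" using primitive_root_nonzero[OF root] .
  let ?d = "\<lambda>k. q powi (1 - (int k)\<^sup>2) * alpha q k"
  have "H7 p q = (\<Sum>n<N. (\<Sum>k<N. ?d k * bailey_weight q k n) * bailey_chain q p n)"
    unfolding H7_eq_sum_bailey_chain[OF root assms(1)]
    by (intro sum.cong refl) (simp add: sum_alpha_bailey_weight[OF root])
  also have "\<dots> = (\<Sum>k<N. ?d k * (\<Sum>n<N. bailey_weight q k n * bailey_chain q p n))"
    by (simp add: sum_distrib_left sum_distrib_right mult.assoc) (rule sum.swap)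
  also have "\<dots> = (\<Sum>k<N. q * ((- 1) ^ k * q ^ (((k + 1) choose 2) + (p - 1) * (k\<^sup>2 + k)) * alpha q k))"
  proof (intro sum.cong refl)
    fix k assume k: "k \<in> {..<N}"
    let ?e = "p * (k\<^sup>2 + k) + (k choose 2)"
    \<comment> \<open>The weight vanishes for \<open>n > k\<close>, so the sum stops at
      \<open>k\<close>.\<close>
    have "(\<Sum>n<N. bailey_weight q k n * bailey_chain q p n) = (\<Sum>n\<le>k. bailey_weight q k n * bailey_chain q p n)"
      using k by (intro sum.mono_neutral_right) (auto simp: bailey_weight_def gauss_binomial_eq_0)
    also have "\<dots> = (- 1) ^ k * q powi int ?e"
      unfolding power_int_of_nat using sum_bailey_weight_chain[OF root, of k p] k by (simp add: power_add)
    finally have "?d k * (\<Sum>n<N. bailey_weight q k n * bailey_chain q p n) =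
        (- 1) ^ k * (q powi (1 - (int k)\<^sup>2) * q powi int ?e) * alpha q k"
      by simp
    \<comment> \<open>One of the \<open>p\<close> eigenvalues absorbs \<open>q powi (- k^2)\<close>:
      the remaining \<open>k\<close> raises \<open>k choose 2\<close> to
      \<open>(k + 1) choose 2\<close>, and the 1 becomes the factor \<open>q\<close> in front of the
      sum.\<close>
    also have "q powi (1 - (int k)\<^sup>2) * q powi int ?e = q powi int (1 + (((k + 1) choose 2) + (p - 1) * (k\<^sup>2 + k)))"
    proof -
      obtain s where "p = Suc s" using assms(1) by (cases p) auto
      then have "1 - (int k)\<^sup>2 + int ?e = int (1 + (((k + 1) choose 2) + (p - 1) * (k\<^sup>2 + k)))"
        by (simp add: numeral_2_eq_2)
      then show ?thesis using q by (metis power_int_add)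
    qed
    also have "\<dots> = q * q ^ (((k + 1) choose 2) + (p - 1) * (k\<^sup>2 + k))"
      by (simp only: power_int_of_nat) simp
    finally show "?d k * (\<Sum>n<N. bailey_weight q k n * bailey_chain q p n) =
        q * ((- 1) ^ k * q ^ (((k + 1) choose 2) + (p - 1) * (k\<^sup>2 + k)) * alpha q k)"
      by (simp only: mult_ac)
  qed
  also have "\<dots> = q * (\<Sum>k = 0..N - 1. (- 1) ^ k * q ^ (((k + 1) choose 2) + (p - 1) * (k\<^sup>2 + k)) * alpha q k)"
  proof -
    have "{..<N} = {0..N - 1}" using assms(2) by auto
    then show ?thesis by (simp only: sum_distrib_left)
  qed
  finally show ?thesis .
qed

end
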